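(* Let $Y_1,\ldots,Y_n$ be $n$ mutually commuting linear vector fields in $\mathbb{R}^n$ with $Y_1\wedge\cdots\wedge Y_n\neq0$, let $(\alpha^{jk})\in\mathfrak{gl}(n,\mathbb{R})$ be skew-symmetric, and put $X_j=\sum_k\alpha^{jk}Y_k$, $\delta_j=\operatorname{div}X_j$. Let $\vec{a}=(a_1,\ldots,a_n)$ be the commuting matrices in $\mathfrak{gl}(n,\mathbb{R})$ corresponding to the $Y_k$, viewed as operators on $\mathbb{C}^n$. Then, for every $r\in\mathbb{N}$, any basis of $\mathbb{C}^n$ in which the commuting operators $\vec{a}$ have an upper-triangular representation naturally induces a basis of $E_r^{\mathbb{C}}=\mathcal{S}^r\mathbb{C}^{n*}$ in which all the transformations $(X_j-\delta_j\operatorname{id})^{\mathbb{C}}$, $j\in\{1,\ldots,n\}$, are upper-triangular.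
   Context: Write $Y_k=\sum_{m,p}a_k^{mp}x_p\partial_{x_m}$; then $a_k=(a_k^{mp})_{m,p}$ ($m$ row index, $p$ column index). $E_r=\mathcal{S}^r\mathbb{R}^{n*}$ is the space of homogeneous polynomials of degree $r$ on $\mathbb{R}^n$, on which vector fields act as derivations, $E_r^{\mathbb{C}}$ is its complexification (degree $r$ homogeneous complex polynomials on $\mathbb{C}^n$), and the superscript $\mathbb{C}$ on operators denotes complexification. "Naturally induces": if $(e_1',\ldots,e_n')$ is the basis of $\mathbb{C}^n$ and $\mathfrak{z}_1,\ldots,\mathfrak{z}_n$ are the components of vectors in this basis (the dual basis), the induced basis of $E_r^{\mathbb{C}}$ consists of the monomials $\mathfrak{z}^\beta=\mathfrak{z}_1^{\beta_1}\cdots\mathfrak{z}_n^{\beta_n}$, $\beta\in\mathbb{N}^n$, $|\beta|=r$, arranged according to the lexicographic order $\prec$ on exponents (so that $\mathfrak{z}^{\beta-e_m+e_p}\prec\mathfrak{z}^\beta$ whenever $m<p$ and $\beta_m\ge1$, where $e_m$ denotes the $m$-th unit multi-index). *)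

theory Defs
  imports "HOL-Analysis.Analysis" "HOL-Library.Poly_Mapping"
begin

text \<open>
  The dimension \<open>n\<close> is the cardinality of a finite, linearly ordered index type \<open>'n\<close>, which plays the
  role of \<open>{1, \<dots>, n}\<close>; the linear order is needed to speak of triangular matrices and of the
  lexicographic order on exponents.
\<close>

definition basis_of ::
  "('a::comm_ring_1 \<Rightarrow> 'v::ab_group_add \<Rightarrow> 'v) \<Rightarrow> ('i \<Rightarrow> 'v) \<Rightarrow> 'i set \<Rightarrow> 'v set \<Rightarrow> bool" where
  "basis_of smul b I S \<longleftrightarrow>
     inj_on b I \<and> \<not> module.dependent smul (b ` I) \<and> module.span smul (b ` I) = S"

text \<open>
  The columns of \<open>M\<close> hold the coordinates of the images of the basis vectors. The index set \<open>I\<close> is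
  meant to be finite and \<open>b\<close> to be a basis, so that \<open>M\<close> is determined by \<open>T\<close> on \<open>I \<times> I\<close>.
\<close>
definition upper_triangular_in ::
  "('a::comm_ring_1 \<Rightarrow> 'v::ab_group_add \<Rightarrow> 'v) \<Rightarrow> ('i::linorder \<Rightarrow> 'v) \<Rightarrow> 'i set \<Rightarrow> ('v \<Rightarrow> 'v) \<Rightarrow> bool" where
  "upper_triangular_in smul b I T \<longleftrightarrow>
     (\<exists>M :: 'i \<Rightarrow> 'i \<Rightarrow> 'a.
        (\<forall>j\<in>I. T (b j) = (\<Sum>i\<in>I. smul (M i j) (b i))) \<and>
        (\<forall>i\<in>I. \<forall>j\<in>I. j < i \<longrightarrow> M i j = 0))"

definition lie_bracket ::
  "(real^'n \<Rightarrow> real^'n) \<Rightarrow> (real^'n \<Rightarrow> real^'n) \<Rightarrow> real^'n \<Rightarrow> real^'n::finite" where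
  "lie_bracket V W x =
     frechet_derivative W (at x) (V x) - frechet_derivative V (at x) (W x)"

definition divergence :: "(real^'n \<Rightarrow> real^'n) \<Rightarrow> real^'n::finite \<Rightarrow> real" where
  "divergence V x = (\<Sum>m\<in>UNIV. frechet_derivative V (at x) (axis m 1) $ m)"

text \<open>
  The coefficient of \<open>Y\<^sub>1 \<and> \<dots> \<and> Y\<^sub>n\<close> with respect to \<open>\<partial>\<^sub>1 \<and> \<dots> \<and> \<partial>\<^sub>n\<close>, as a function of the point.
\<close>
definition wedge_all :: "('n \<Rightarrow> real^'n \<Rightarrow> real^'n) \<Rightarrow> real^'n::finite \<Rightarrow> real" where
  "wedge_all Y x = det (\<chi> m k. Y k x $ m)"

text \<open>
  A polynomial is its finitely supported family of coefficients, indexed by exponents. The order on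
  exponents \<open>'n \<Rightarrow>\<^sub>0 nat\<close> provided by the library is the lexicographic one, the smallest index being
  the most significant; see \<open>exponent_shift_less\<close>.
\<close>
type_synonym ('n, 'a) polynomial = "('n \<Rightarrow>\<^sub>0 nat) \<Rightarrow>\<^sub>0 'a"

definition total_degree :: "('n::finite \<Rightarrow>\<^sub>0 nat) \<Rightarrow> nat" where
  "total_degree \<beta> = (\<Sum>i\<in>UNIV. Poly_Mapping.lookup \<beta> i)"

definition homogeneous :: "nat \<Rightarrow> ('n::finite, 'a::zero) polynomial set" where
  "homogeneous r = {P. \<forall>\<beta>\<in>Poly_Mapping.keys P. total_degree \<beta> = r}"

definition poly_scale :: "'a::comm_ring_1 \<Rightarrow> ('n, 'a) polynomial \<Rightarrow> ('n, 'a) polynomial" where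
  "poly_scale c P = Poly_Mapping.map (\<lambda>a. c * a) P"

definition poly_var :: "'n \<Rightarrow> ('n, 'a::comm_ring_1) polynomial" where
  "poly_var p = Poly_Mapping.single (Poly_Mapping.single p 1) 1"

definition partial_deriv :: "'n \<Rightarrow> ('n, 'a::comm_ring_1) polynomial \<Rightarrow> ('n, 'a) polynomial" where
  "partial_deriv m P =
     (\<Sum>\<beta>\<in>Poly_Mapping.keys P.
        Poly_Mapping.single (\<beta> - Poly_Mapping.single m 1)
          (of_nat (Poly_Mapping.lookup \<beta> m) * Poly_Mapping.lookup P \<beta>))"

text \<open>
  The linear vector field \<open>V\<close> acting as the derivation
  \<open>\<Sum>\<^sub>m\<^sub>,\<^sub>p a\<^sup>m\<^sup>p x\<^sub>p \<partial>\<^sub>m\<close>, where \<open>a\<close> is the matrix of \<open>V\<close>.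
\<close>
definition field_action ::
  "(real^'n \<Rightarrow> real^'n) \<Rightarrow> ('n::finite, real) polynomial \<Rightarrow> ('n, real) polynomial" where
  "field_action V P =
     (\<Sum>m\<in>UNIV. \<Sum>p\<in>UNIV. poly_scale (matrix V $ m $ p) (poly_var p * partial_deriv m P))"

text \<open>
  Complexification: \<open>T\<^sup>\<complex>(P + iQ) = T P + i T Q\<close> for real polynomials \<open>P\<close>, \<open>Q\<close>.
\<close>
definition complexify ::
  "(('n, real) polynomial \<Rightarrow> ('n, real) polynomial) \<Rightarrow>
   ('n, complex) polynomial \<Rightarrow> ('n, complex) polynomial" where
  "complexify T P =
     Poly_Mapping.map complex_of_real (T (Poly_Mapping.map Re P)) +
     poly_scale \<i> (Poly_Mapping.map complex_of_real (T (Poly_Mapping.map Im P)))"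

definition component :: "('n \<Rightarrow> complex^'n) \<Rightarrow> 'n \<Rightarrow> complex^'n \<Rightarrow> complex" where
  "component e m v = module.representation (*s) (range e) v (e m)"

text \<open>The linear form \<open>component e m\<close> as an element of \<open>homogeneous 1\<close>.\<close>
definition component_poly :: "('n \<Rightarrow> complex^'n) \<Rightarrow> 'n::finite \<Rightarrow> ('n, complex) polynomial" where
  "component_poly e m = (\<Sum>p\<in>UNIV. poly_scale (component e m (axis p 1)) (poly_var p))"

definition induced_monomial ::
  "('n \<Rightarrow> complex^'n) \<Rightarrow> ('n::finite \<Rightarrow>\<^sub>0 nat) \<Rightarrow> ('n, complex) polynomial" where
  "induced_monomial e \<beta> = (\<Prod>m\<in>UNIV. component_poly e m ^ Poly_Mapping.lookup \<beta> m)"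

lemma lookup_poly_scale [simp]:
  "Poly_Mapping.lookup (poly_scale c P) \<beta> = c * Poly_Mapping.lookup P \<beta>"
  unfolding poly_scale_def by (simp add: Poly_Mapping.map.rep_eq when_def)

lemma vector_space_poly_scale:
  "vector_space (poly_scale :: 'a::field \<Rightarrow> ('n, 'a) polynomial \<Rightarrow> ('n, 'a) polynomial)"
  by unfold_locales (auto intro!: poly_mapping_eqI simp: lookup_add algebra_simps)

lemma finite_exponents: "finite {\<beta> :: 'n::finite \<Rightarrow>\<^sub>0 nat. total_degree \<beta> = r}"
proof (rule finite_imageD)
  have "Poly_Mapping.lookup ` {\<beta> :: 'n \<Rightarrow>\<^sub>0 nat. total_degree \<beta> = r}
          \<subseteq> (UNIV :: 'n set) \<rightarrow>\<^sub>E {..r}"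
    by (auto simp: total_degree_def intro!: member_le_sum)
  then show "finite (Poly_Mapping.lookup ` {\<beta> :: 'n \<Rightarrow>\<^sub>0 nat. total_degree \<beta> = r})"
    by (rule finite_subset) (simp add: finite_PiE)
  show "inj_on Poly_Mapping.lookup {\<beta> :: 'n \<Rightarrow>\<^sub>0 nat. total_degree \<beta> = r}"
    by (simp add: inj_on_def)
qed

lemma exponent_shift_less:
  fixes \<beta> :: "'n::{finite,linorder} \<Rightarrow>\<^sub>0 nat"
  assumes "m < p" "1 \<le> Poly_Mapping.lookup \<beta> m"
  shows "\<beta> - Poly_Mapping.single m 1 + Poly_Mapping.single p 1 < \<beta>"
  using assms unfolding less_poly_mapping.rep_eq less_fun_def
  by (intro exI[of _ m]) (auto simp: lookup_add lookup_minus lookup_single when_def)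

end

theory Submission
  imports Defs
begin

text \<open>
  If \<open>\<zeta>\<^sub>m\<close> are the coordinates of a basis in which the matrix \<open>A\<close> is represented by the
  upper-triangular matrix \<open>M\<close>, then the derivation defined by \<open>A\<close> sends \<open>\<zeta>\<^sub>m\<close> to
  \<open>\<Sum>\<^sub>p M\<^sup>m\<^sup>p \<zeta>\<^sub>p\<close>, where only \<open>p \<ge> m\<close> contribute. By the Leibniz rule it sends \<open>\<zeta>\<^sup>\<beta>\<close> to a
  combination of the monomials with exponents \<open>\<beta> - e\<^sub>m + e\<^sub>p\<close>, where \<open>m \<le> p\<close> and \<open>\<beta>\<^sub>m \<ge> 1\<close>, and
  these are lexicographically at most \<open>\<beta>\<close>. Subtracting \<open>\<delta>\<^sub>j id\<close> changes only the diagonal. The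
  monomials in \<open>\<zeta>\<close> span all homogeneous polynomials, since each \<open>x\<^sub>p\<close> is a combination of the
  \<open>\<zeta>\<^sub>m\<close>; there are as many of them as monomials in \<open>x\<close>, so they form a basis.
\<close>

section \<open>Bases by counting, triangularity via flags, and derivations of products\<close>

text \<open>Both families share the finite index set \<open>I\<close>, and no set with fewer than
  \<open>card I\<close> vectors can span the independent family \<open>c\<close>. So
  \<open>b\<close> can neither repeat a vector nor contain a redundant one.\<close>

lemma (in vector_space) spanning_family_is_basis:
  assumes "finite I" "inj_on c I" "independent (c ` I)" "c ` I \<subseteq> span (b ` I)"
  shows "inj_on b I" "independent (b ` I)"
proof -
  have card_le: "card I \<le> card T" if "finite T" "c ` I \<subseteq> span T" for T
    using independent_span_bound[OF that(1) assms(3) that(2)] by (simp add: card_image[OF assms(2)])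
  have "card I \<le> card (b ` I)"
    using card_le[of "b ` I"] assms by simp
  with card_image_le[OF assms(1), of b] show "inj_on b I"
    by (intro eq_card_imp_inj_on assms(1)) simp
  show "independent (b ` I)"
  proof
    assume "dependent (b ` I)"
    then obtain a where a: "a \<in> b ` I" "a \<in> span (b ` I - {a})"
      by (auto simp: dependent_def)
    \<comment> \<open>Dropping the redundant \<open>a\<close> would leave a spanning set with fewer
      than \<open>card I\<close> elements.\<close>
    then have "span (b ` I - {a}) = span (b ` I)"
      using span_redundant[OF a(2)] by (simp add: insert_absorb)
    then have "card I \<le> card (b ` I - {a})"
      using card_le[of "b ` I - {a}"] assms by simp
    also have "\<dots> < card (b ` I)"
      using a(1) assms(1) by (intro psubset_card_mono) auto
    also have "\<dots> \<le> card I"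
      by (rule card_image_le[OF assms(1)])
    finally show False by simp
  qed
qed

text \<open>Replaces the search for a matrix by invariance of a flag of spans. Coefficients in a
  span belong to vectors; injectivity of \<open>b\<close> lets them be read as belonging to
  indices.\<close>

lemma (in module) upper_triangular_inI:
  fixes b :: "'i::linorder \<Rightarrow> 'b"
  assumes "finite I" "inj_on b I" "\<And>j. j \<in> I \<Longrightarrow> T (b j) \<in> span (b ` {i \<in> I. i \<le> j})"
  shows "upper_triangular_in scale b I T"
proof -
  have "\<exists>u. T (b j) = (\<Sum>i\<in>{i \<in> I. i \<le> j}. u (b i) *s b i)" if "j \<in> I" for j
  proof -
    have inj: "inj_on b {i \<in> I. i \<le> j}"
      using assms(2) by (rule inj_on_subset) auto
    from assms(3)[OF that] obtain u where "T (b j) = (\<Sum>v\<in>b ` {i \<in> I. i \<le> j}. u v *s v)"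
      using assms(1) by (auto simp: span_finite)
    then show ?thesis
      by (auto simp: sum.reindex[OF inj])
  qed
  then obtain u where u: "\<And>j. j \<in> I \<Longrightarrow> T (b j) = (\<Sum>i\<in>{i \<in> I. i \<le> j}. u j (b i) *s b i)"
    by metis
  have "T (b j) = (\<Sum>i\<in>I. (if i \<le> j then u j (b i) else 0) *s b i)" if "j \<in> I" for j
    unfolding u[OF that] using assms(1) by (intro sum.mono_neutral_cong_left) auto
  then show ?thesis
    unfolding upper_triangular_in_def
    by (intro exI[of _ "\<lambda>i j. if i \<le> j then u j (b i) else 0"]) auto
qed

text \<open>Induction on the exponent, then on the set of factors. The truncated exponent
  \<open>k m - 1\<close> is harmless at \<open>k m = 0\<close>, where the factor
  \<open>of_nat (k m)\<close> vanishes.\<close>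

lemma derivation_prod_power:
  fixes D :: "'a::comm_ring_1 \<Rightarrow> 'a"
  assumes "\<And>x y. D (x * y) = x * D y + D x * y" and "finite S"
  shows "D (\<Prod>m\<in>S. f m ^ k m) =
    (\<Sum>m\<in>S. of_nat (k m) * D (f m) * (f m ^ (k m - 1) * (\<Prod>i\<in>S - {m}. f i ^ k i)))"
proof -
  \<comment> \<open>From 1 = 1 * 1 the product rule gives D 1 = D 1 + D 1.\<close>
  have one: "D 1 = 0"
    using assms(1)[of 1 1] by simp
  have power: "D (x ^ n) = of_nat n * D x * x ^ (n - 1)" for x n
  proof (induction n)
    case (Suc n)
    then show ?case
      by (cases n) (simp_all add: assms(1) algebra_simps)
  qed (simp add: one)
  show ?thesis
    using assms(2)
  proof (induction S rule: finite_induct)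
    case (insert a S)
    have "(\<Prod>i\<in>insert a S - {m}. f i ^ k i) = f a ^ k a * (\<Prod>i\<in>S - {m}. f i ^ k i)" if "m \<in> S" for m
    proof -
      have "insert a S - {m} = insert a (S - {m})"
        using insert.hyps that by auto
      then show ?thesis
        using insert.hyps by simp
    qed
    moreover have "insert a S - {a} = S"
      using insert.hyps by auto
    ultimately show ?case
      using insert
      by (simp add: assms(1) power sum_distrib_left algebra_simps cong: sum.cong)
  qed (simp add: one)
qed

section \<open>Polynomials\<close>

interpretation poly: vector_space "poly_scale :: 'a::field \<Rightarrow> ('n, 'a) polynomial \<Rightarrow> ('n, 'a) polynomial"
  by (rule vector_space_poly_scale)

lemma poly_scale_conv_mult: "poly_scale c P = Poly_Mapping.single 0 c * P"
  unfolding poly_scale_def by (rule mult_map_scale_conv_mult)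

lemma poly_scale_of_nat: "poly_scale (of_nat k) P = of_nat k * P"
  by (simp add: poly_scale_conv_mult)

text \<open>Reduces additive identities to monomials: updating at a key outside the support is the
  same as adding a single term.\<close>

lemma poly_mapping_single_add_induct [case_names single add]:
  fixes P :: "'a \<Rightarrow>\<^sub>0 'b::comm_monoid_add"
  assumes "\<And>k c. Q (Poly_Mapping.single k c)" "\<And>P P'. Q P \<Longrightarrow> Q P' \<Longrightarrow> Q (P + P')"
  shows "Q P"
proof (induction P rule: update_induct)
  case const
  show ?case using assms(1)[of undefined 0] by simp
next
  case (update P k c)
  have "Poly_Mapping.update k c P = P + Poly_Mapping.single k c"
    using update.hyps
    by (intro poly_mapping_eqI) (auto simp: lookup_update lookup_add lookup_single when_def in_keys_iff)
  then show ?case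
    using update assms by simp
qed

text \<open>Subtraction of exponents is truncated, hence the guard: only exponents divisible by the
  variable receive a coefficient.\<close>

lemma lookup_poly_var_mult:
  "Poly_Mapping.lookup (poly_var p * P) \<beta> =
    (Poly_Mapping.lookup P (\<beta> - Poly_Mapping.single p 1) when Poly_Mapping.lookup \<beta> p \<noteq> 0)"
proof (induction P rule: poly_mapping_single_add_induct)
  case (single k c)
  have "Poly_Mapping.single p 1 + k = \<beta> \<longleftrightarrow>
      k = \<beta> - Poly_Mapping.single p 1 \<and> Poly_Mapping.lookup \<beta> p \<noteq> 0"
    by (auto simp: poly_mapping_eq_iff fun_eq_iff lookup_add lookup_minus lookup_single when_def)
  then show ?case
    by (auto simp: poly_var_def mult_single lookup_single when_def)
next
  case (add P P')
  then show ?case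
    by (simp add: distrib_left lookup_add when_add_distrib)
qed

lemma lookup_partial_deriv:
  "Poly_Mapping.lookup (partial_deriv m P) \<beta> =
    of_nat (Suc (Poly_Mapping.lookup \<beta> m)) * Poly_Mapping.lookup P (\<beta> + Poly_Mapping.single m 1)"
proof -
  let ?e = "Poly_Mapping.single m (1::nat)"
  have "(of_nat (Poly_Mapping.lookup \<gamma> m) * Poly_Mapping.lookup P \<gamma> when \<gamma> - ?e = \<beta>) =
      (of_nat (Suc (Poly_Mapping.lookup \<beta> m)) * Poly_Mapping.lookup P (\<beta> + ?e) when \<gamma> = \<beta> + ?e)" for \<gamma>
  \<comment> \<open>If the exponent at \<open>m\<close> is zero, truncated subtraction leaves
    \<gamma> unchanged and may hit \<beta>, but the derivative's factor is then zero.\<close>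
  proof (cases "Poly_Mapping.lookup \<gamma> m = 0")
    case True
    then have "\<gamma> \<noteq> \<beta> + ?e"
      by (auto simp: lookup_add)
    with True show ?thesis by simp
  next
    case False
    then have "\<gamma> - ?e = \<beta> \<longleftrightarrow> \<gamma> = \<beta> + ?e"
      by (auto simp: poly_mapping_eq_iff fun_eq_iff lookup_add lookup_minus lookup_single when_def)
    then show ?thesis
      by (auto simp: when_def lookup_add)
  qed
  then show ?thesis
    by (simp add: partial_deriv_def lookup_sum lookup_single)
      (auto simp: when_def in_keys_iff)
qed

lemma partial_deriv_single:
  "partial_deriv m (Poly_Mapping.single \<beta> c) =
    Poly_Mapping.single (\<beta> - Poly_Mapping.single m 1) (of_nat (Poly_Mapping.lookup \<beta> m) * c)"
  by (simp add: partial_deriv_def)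

lemma partial_deriv_add: "partial_deriv m (P + Q) = partial_deriv m P + partial_deriv m Q"
  by (rule poly_mapping_eqI) (simp only: lookup_partial_deriv lookup_add distrib_left)

lemma partial_deriv_scale: "partial_deriv m (poly_scale c P) = poly_scale c (partial_deriv m P)"
  by (rule poly_mapping_eqI) (simp only: lookup_partial_deriv lookup_poly_scale mult.left_commute)

text \<open>Both sides are additive in each argument, so it suffices to compare monomials.\<close>

lemma partial_deriv_mult:
  "partial_deriv m (P * Q) = P * partial_deriv m Q + partial_deriv m P * Q"
proof (induction P rule: poly_mapping_single_add_induct)
  case (single \<beta> c)
  show ?case
  proof (induction Q rule: poly_mapping_single_add_induct)
    case (single \<gamma> d)
    \<comment> \<open>Truncated subtraction can be reassociated only at a positive exponent; at
      exponent zero the corresponding Leibniz term vanishes.\<close>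
    have shift: "\<beta> + (\<gamma> - Poly_Mapping.single m (Suc 0)) = \<beta> + \<gamma> - Poly_Mapping.single m (Suc 0)"
      if "Poly_Mapping.lookup \<gamma> m \<noteq> 0" for \<beta> \<gamma>
      using that
      by (auto simp: poly_mapping_eq_iff fun_eq_iff lookup_add lookup_minus lookup_single when_def)
    show ?case
      by (cases "Poly_Mapping.lookup \<beta> m = 0"; cases "Poly_Mapping.lookup \<gamma> m = 0")
        (simp_all add: partial_deriv_single mult_single lookup_add shift algebra_simps
          flip: single_add)
  next
    case (add Q Q')
    then show ?case by (simp add: distrib_left partial_deriv_add algebra_simps)
  qed
next
  case (add P P')
  then show ?case by (simp add: distrib_right partial_deriv_add algebra_simps)
qed

lemma partial_deriv_poly_var: "partial_deriv m (poly_var q) = (if q = m then 1 else 0)"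
  by (auto simp: poly_var_def partial_deriv_single lookup_single)

section \<open>Degrees, homogeneous polynomials and the standard monomials\<close>

lemma total_degree_add: "total_degree (\<beta> + \<gamma>) = total_degree \<beta> + total_degree \<gamma>"
  by (simp add: total_degree_def lookup_add sum.distrib)

lemma total_degree_single: "total_degree (Poly_Mapping.single p k) = k"
  by (simp add: total_degree_def lookup_single when_def)

lemma exponent_split:
  fixes \<beta> :: "'n \<Rightarrow>\<^sub>0 nat"
  assumes "Poly_Mapping.lookup \<beta> p \<noteq> 0"
  shows "\<beta> = Poly_Mapping.single p 1 + (\<beta> - Poly_Mapping.single p 1)"
  using assms
  by (auto simp: poly_mapping_eq_iff fun_eq_iff lookup_add lookup_minus lookup_single when_def)

lemma subspace_homogeneous:
  "poly.subspace (homogeneous r :: ('n::finite, 'a::field) polynomial set)"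
  unfolding poly.subspace_def homogeneous_def
  by (auto simp: in_keys_iff lookup_add)

lemma homogeneous_mult:
  "P \<in> homogeneous r \<Longrightarrow> Q \<in> homogeneous s \<Longrightarrow> P * Q \<in> homogeneous (r + s)"
  using keys_mult[of P Q] by (fastforce simp: homogeneous_def total_degree_add)

lemma homogeneous_prod_power:
  assumes "\<And>m. f m \<in> homogeneous 1"
  shows "(\<Prod>m\<in>S. f m ^ k m) \<in> homogeneous (\<Sum>m\<in>S. k m)"
proof -
  have one: "1 \<in> homogeneous 0"
    by (simp add: homogeneous_def total_degree_def)
  have "f m ^ n \<in> homogeneous n" for m n
  proof (induction n)
    case (Suc n)
    then show ?case
      using homogeneous_mult[OF assms[of m] Suc] by simp
  qed (simp add: one)
  then show ?thesis
    by (induction S rule: infinite_finite_induct) (simp_all add: one homogeneous_mult)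
qed

lemma homogeneous_eq_span:
  "(homogeneous r :: ('n::finite, 'a::field) polynomial set) =
    poly.span ((\<lambda>\<beta>. Poly_Mapping.single \<beta> 1) ` {\<beta>. total_degree \<beta> = r})"
proof
  show "poly.span ((\<lambda>\<beta>. Poly_Mapping.single \<beta> 1) ` {\<beta>. total_degree \<beta> = r})
      \<subseteq> (homogeneous r :: ('n, 'a) polynomial set)"
    by (rule poly.span_minimal[OF _ subspace_homogeneous]) (auto simp: homogeneous_def)
  show "(homogeneous r :: ('n, 'a) polynomial set)
      \<subseteq> poly.span ((\<lambda>\<beta>. Poly_Mapping.single \<beta> 1) ` {\<beta>. total_degree \<beta> = r})"
  proof
    fix P :: "('n, 'a) polynomial"
    assume P: "P \<in> homogeneous r"
    have "P = (\<Sum>\<beta>\<in>Poly_Mapping.keys P. poly_scale (Poly_Mapping.lookup P \<beta>) (Poly_Mapping.single \<beta> 1))"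
      by (rule poly_mapping_eqI) (simp add: lookup_sum lookup_single when_def in_keys_iff if_distrib cong: if_cong)
    moreover have "\<dots> \<in> poly.span ((\<lambda>\<beta>. Poly_Mapping.single \<beta> 1) ` {\<beta>. total_degree \<beta> = r})"
      using P
      by (intro poly.span_sum poly.span_scale poly.span_base) (auto simp: homogeneous_def)
    ultimately show "P \<in> poly.span ((\<lambda>\<beta>. Poly_Mapping.single \<beta> 1) ` {\<beta>. total_degree \<beta> = r})"
      by simp
  qed
qed

lemma inj_single_one: "inj_on (\<lambda>\<beta>. Poly_Mapping.single \<beta> (1::'a::zero_neq_one)) I"
proof (rule inj_onI)
  fix \<beta> \<gamma> :: 'b
  assume "Poly_Mapping.single \<beta> (1::'a) = Poly_Mapping.single \<gamma> 1"
  then have "Poly_Mapping.keys (Poly_Mapping.single \<beta> (1::'a)) = Poly_Mapping.keys (Poly_Mapping.single \<gamma> (1::'a))"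
    by simp
  then show "\<beta> = \<gamma>" by simp
qed

text \<open>Reading off the coefficient at one exponent isolates one scalar of a vanishing
  combination.\<close>

lemma independent_monomials:
  fixes I :: "('n \<Rightarrow>\<^sub>0 nat) set"
  assumes "finite I"
  shows "poly.independent ((\<lambda>\<beta>. Poly_Mapping.single \<beta> (1::'a::field)) ` I)"
proof (rule poly.independent_if_scalars_zero)
  fix f :: "('n, 'a) polynomial \<Rightarrow> 'a" and P :: "('n, 'a) polynomial"
  assume zero: "(\<Sum>P\<in>(\<lambda>\<beta>. Poly_Mapping.single \<beta> 1) ` I. poly_scale (f P) P) = 0"
    and "P \<in> (\<lambda>\<beta>. Poly_Mapping.single \<beta> 1) ` I"
  then obtain \<beta> where \<beta>: "\<beta> \<in> I" "P = Poly_Mapping.single \<beta> 1"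
    by auto
  have "0 = Poly_Mapping.lookup (\<Sum>\<gamma>\<in>I. poly_scale (f (Poly_Mapping.single \<gamma> 1)) (Poly_Mapping.single \<gamma> 1)) \<beta>"
    using zero by (simp add: sum.reindex[OF inj_single_one])
  also have "\<dots> = f P"
    using \<beta> assms by (simp add: lookup_sum lookup_single when_def if_distrib cong: if_cong)
  finally show "f P = 0" by simp
qed (use assms in simp)

section \<open>Linear vector fields as derivations\<close>

text \<open>The formula of \<open>field_action\<close> for an arbitrary matrix over any commutative
  ring, so that the complexified operators are again derivations of this form.\<close>

definition matrix_action ::
  "'a::comm_ring_1^'n^'n \<Rightarrow> ('n::finite, 'a) polynomial \<Rightarrow> ('n, 'a) polynomial" where
  "matrix_action A P =
    (\<Sum>m\<in>UNIV. \<Sum>p\<in>UNIV. poly_scale (A $ m $ p) (poly_var p * partial_deriv m P))"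

lemma matrix_action_add: "matrix_action A (P + Q) = matrix_action A P + matrix_action A Q"
  by (simp add: matrix_action_def partial_deriv_add poly_scale_conv_mult distrib_left sum.distrib)

lemma matrix_action_scale: "matrix_action A (poly_scale c P) = poly_scale c (matrix_action A P)"
  by (simp add: matrix_action_def partial_deriv_scale)
    (simp add: poly_scale_conv_mult sum_distrib_left mult.left_commute)

lemma matrix_action_zero: "matrix_action A 0 = 0"
  using matrix_action_add[of A 0 0] by simp

lemma matrix_action_sum: "matrix_action A (sum f S) = (\<Sum>i\<in>S. matrix_action A (f i))"
  by (induction S rule: infinite_finite_induct) (simp_all add: matrix_action_zero matrix_action_add)

lemma matrix_action_mult:
  "matrix_action A (P * Q) = P * matrix_action A Q + matrix_action A P * Q"
  by (simp add: matrix_action_def partial_deriv_mult poly_scale_conv_mult sum_distrib_left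
      sum_distrib_right sum.distrib algebra_simps)

lemma matrix_action_poly_var:
  "matrix_action A (poly_var q) = (\<Sum>p\<in>UNIV. poly_scale (A $ q $ p) (poly_var p))"
proof -
  have "matrix_action A (poly_var q) =
      (\<Sum>m\<in>UNIV. if q = m then \<Sum>p\<in>UNIV. poly_scale (A $ m $ p) (poly_var p) else 0)"
    unfolding matrix_action_def
    by (intro sum.cong) (auto simp: partial_deriv_poly_var poly_scale_conv_mult)
  then show ?thesis by simp
qed

text \<open>The matrix of \<open>V\<close> and the scalar \<open>d\<close> are real, so the operator
  acts separately on real and imaginary parts of each coefficient.\<close>

lemma complexify_field_action:
  "complexify (\<lambda>P. field_action V P - poly_scale d P) =
    (\<lambda>P. matrix_action (map_matrix complex_of_real (matrix V)) P - poly_scale (complex_of_real d) P)"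
proof (intro ext poly_mapping_eqI)
  fix P \<beta>
  have map: "Poly_Mapping.lookup (Poly_Mapping.map f Q) \<gamma> = f (Poly_Mapping.lookup Q \<gamma>)"
    if "f 0 = 0" for f :: "'b::zero \<Rightarrow> 'c::zero" and Q :: "('n \<Rightarrow>\<^sub>0 nat) \<Rightarrow>\<^sub>0 'b" and \<gamma>
    using that by (simp add: Poly_Mapping.map.rep_eq when_def)
  show "Poly_Mapping.lookup (complexify (\<lambda>P. field_action V P - poly_scale d P) P) \<beta> =
      Poly_Mapping.lookup (matrix_action (map_matrix complex_of_real (matrix V)) P
        - poly_scale (complex_of_real d) P) \<beta>"
    by (rule complex_eqI)
      (simp_all add: complexify_def field_action_def matrix_action_def map lookup_add lookup_minus
        lookup_sum lookup_poly_var_mult lookup_partial_deriv map_matrix_def when_def if_distrib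
        Re_sum Im_sum cong: if_cong)
qed

section \<open>Coordinates with respect to a triangularising basis\<close>

locale complex_basis =
  fixes e :: "'n \<Rightarrow> complex^'n::finite"
  assumes basis: "basis_of (*s) e UNIV UNIV"
begin

lemma inj: "inj e" and indep: "vec.independent (range e)" and spanning: "vec.span (range e) = UNIV"
  using basis by (auto simp: basis_of_def)

lemma component_expansion: "(\<Sum>m\<in>UNIV. component e m v *s e m) = v"
proof -
  have "(\<Sum>b\<in>range e. vec.representation (range e) v b *s b) = v"
    by (rule vec.sum_representation_eq) (simp_all add: indep spanning)
  then show ?thesis
    by (simp add: component_def sum.reindex[OF inj])
qed

lemma component_sum: "component e m (sum f S) = (\<Sum>i\<in>S. component e m (f i))"
  by (simp add: component_def vec.representation_sum[OF indep] spanning)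

lemma component_scale: "component e m (c *s v) = c * component e m v"
  by (simp add: component_def vec.representation_scale[OF indep] spanning)

lemma component_basis: "component e m (e p) = (if m = p then 1 else 0)"
  by (simp add: component_def vec.representation_basis[OF indep] inj_eq[OF inj])

text \<open>The inverse change of variables: the \<open>p\<close>-th entry of the expansion of a
  vector in the basis \<open>e\<close>, evaluated on the standard unit vectors.\<close>

lemma poly_var_eq: "poly_var p = (\<Sum>m\<in>UNIV. poly_scale (e m $ p) (component_poly e m))"
proof -
  have *: "(\<Sum>m\<in>UNIV. e m $ p * component e m v) = v $ p" for v
    using arg_cong[OF component_expansion[of v], of "\<lambda>w. w $ p"] by (simp add: mult.commute)
  have "(\<Sum>m\<in>UNIV. poly_scale (e m $ p) (component_poly e m)) =
      (\<Sum>q\<in>UNIV. poly_scale (\<Sum>m\<in>UNIV. e m $ p * component e m (axis q 1)) (poly_var q))"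
    unfolding component_poly_def poly.scale_sum_right poly.scale_sum_left
    by (subst sum.swap) simp
  also have "\<dots> = (\<Sum>q\<in>UNIV. if q = p then poly_var q else 0)"
    unfolding * by (intro sum.cong) (auto simp: axis_def)
  finally show ?thesis by simp
qed

lemma component_poly_mult_induced_monomial:
  "component_poly e p * induced_monomial e \<beta> = induced_monomial e (\<beta> + Poly_Mapping.single p 1)"
proof -
  have "induced_monomial e (\<beta> + Poly_Mapping.single p 1) =
      induced_monomial e \<beta> * (\<Prod>m\<in>UNIV. if m = p then component_poly e m else 1)"
    unfolding induced_monomial_def prod.distrib[symmetric]
    by (intro prod.cong) (auto simp: lookup_add lookup_single when_def)
  then show ?thesis by (simp add: mult.commute)
qed

lemma component_poly_homogeneous: "component_poly e m \<in> homogeneous 1"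
  unfolding component_poly_def
  by (intro poly.subspace_sum[OF subspace_homogeneous] poly.subspace_scale[OF subspace_homogeneous])
    (simp add: homogeneous_def poly_var_def total_degree_single)

text \<open>Induction on the degree: split off one variable, write it through the forms
  \<open>component_poly e m\<close>, and use that multiplication by such a form raises the degree of
  induced monomials by one.\<close>

lemma monomial_in_span_induced:
  "total_degree \<beta> = r \<Longrightarrow> Poly_Mapping.single \<beta> 1
    \<in> poly.span (induced_monomial e ` {\<beta>. total_degree \<beta> = r})"
proof (induction r arbitrary: \<beta>)
  case 0
  then have "\<beta> = 0"
    by (intro poly_mapping_eqI) (simp add: total_degree_def)
  then show ?case
    by (intro poly.span_base image_eqI[of _ _ 0])
      (simp_all add: induced_monomial_def total_degree_def)
next
  case (Suc r)
  then obtain p where p: "Poly_Mapping.lookup \<beta> p \<noteq> 0"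
    unfolding total_degree_def by (metis sum.neutral nat.distinct(1))
  define \<gamma> where "\<gamma> = \<beta> - Poly_Mapping.single p 1"
  have \<beta>: "\<beta> = Poly_Mapping.single p 1 + \<gamma>"
    unfolding \<gamma>_def by (rule exponent_split[OF p])
  then have "total_degree \<gamma> = r"
    using Suc.prems by (simp add: total_degree_add total_degree_single)
  then have IH: "Poly_Mapping.single \<gamma> 1 \<in> poly.span (induced_monomial e ` {\<beta>. total_degree \<beta> = r})"
    by (rule Suc.IH)
  have step: "component_poly e m * P \<in> poly.span (induced_monomial e ` {\<beta>. total_degree \<beta> = Suc r})"
    if "P \<in> poly.span (induced_monomial e ` {\<beta>. total_degree \<beta> = r})" for m P
    using that
  proof (induction rule: poly.span_induct_alt)
    case (step c Q P)
    then obtain \<beta>' where "Q = induced_monomial e \<beta>'" "total_degree \<beta>' = r"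
      by auto
    then have "component_poly e m * Q \<in> induced_monomial e ` {\<beta>. total_degree \<beta> = Suc r}"
      by (simp add: component_poly_mult_induced_monomial total_degree_add total_degree_single)
    moreover have "component_poly e m * (poly_scale c Q + P) =
        poly_scale c (component_poly e m * Q) + component_poly e m * P"
      by (simp add: poly_scale_conv_mult algebra_simps)
    ultimately show ?case
      using step by (simp add: poly.span_add poly.span_scale poly.span_base)
  qed (simp add: poly.span_zero)
  have "Poly_Mapping.single \<beta> 1 = poly_var p * Poly_Mapping.single \<gamma> (1::complex)"
    by (simp add: \<beta> poly_var_def mult_single)
  also have "\<dots> = (\<Sum>m\<in>UNIV. poly_scale (e m $ p) (component_poly e m * Poly_Mapping.single \<gamma> 1))"
    by (simp add: poly_var_eq poly_scale_conv_mult sum_distrib_right mult.assoc)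
  finally show ?case
    by (simp add: poly.span_sum poly.span_scale step[OF IH])
qed

text \<open>Standard and induced monomials are indexed by the same exponents, so spanning alone
  yields injectivity and independence.\<close>

lemma induced_monomials_basis:
  "basis_of poly_scale (induced_monomial e) {\<beta>. total_degree \<beta> = r} (homogeneous r)"
proof -
  let ?I = "{\<beta> :: 'n \<Rightarrow>\<^sub>0 nat. total_degree \<beta> = r}"
  let ?c = "\<lambda>\<beta>. Poly_Mapping.single \<beta> (1::complex)"
  have sub: "?c ` ?I \<subseteq> poly.span (induced_monomial e ` ?I)"
    using monomial_in_span_induced by auto
  have "induced_monomial e ` ?I \<subseteq> homogeneous r"
    using homogeneous_prod_power[of "component_poly e", OF component_poly_homogeneous]
    by (auto simp: induced_monomial_def total_degree_def)
  then have "poly.span (induced_monomial e ` ?I) \<subseteq> homogeneous r"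
    by (rule poly.span_minimal[OF _ subspace_homogeneous])
  moreover have "homogeneous r \<subseteq> poly.span (induced_monomial e ` ?I)"
    unfolding homogeneous_eq_span by (rule poly.span_minimal[OF sub poly.subspace_span])
  moreover note poly.spanning_family_is_basis[OF finite_exponents inj_single_one
      independent_monomials[OF finite_exponents] sub]
  ultimately show ?thesis
    by (auto simp: basis_of_def)
qed

section \<open>The action of a matrix on induced monomials\<close>

text \<open>On linear forms the derivation is composition with \<open>A\<close>. Forms are dual to
  vectors, so row \<open>m\<close> of \<open>M\<close> appears where the image of a basis vector
  uses a column.\<close>

lemma matrix_action_component_poly:
  assumes M: "\<And>s. A *v e s = (\<Sum>i\<in>UNIV. M i s *s e i)"
  shows "matrix_action A (component_poly e m) = (\<Sum>s\<in>UNIV. poly_scale (M m s) (component_poly e s))"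
proof -
  have Av: "component e m (A *v v) = (\<Sum>s\<in>UNIV. M m s * component e s v)" for v
  proof -
    have "A *v v = A *v (\<Sum>s\<in>UNIV. component e s v *s e s)"
      by (simp only: component_expansion)
    also have "\<dots> = (\<Sum>s\<in>UNIV. component e s v *s (\<Sum>i\<in>UNIV. M i s *s e i))"
      by (simp only: vec.sum vec.scale M)
    finally show ?thesis
      by (simp add: component_sum component_scale component_basis if_distrib mult.commute cong: if_cong)
  qed
  \<comment> \<open>The coefficient of the variable \<open>p\<close> in the image is the form
    evaluated on column \<open>p\<close> of \<open>A\<close>.\<close>
  have col: "(\<Sum>q\<in>UNIV. component e m (axis q 1) * A $ q $ p) = component e m (A *v axis p 1)" for p
  proof -
    have "A *v axis p 1 = (\<Sum>q\<in>UNIV. A $ q $ p *s axis q 1)"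
      by (simp add: vec_eq_iff matrix_vector_mult_def axis_def if_distrib cong: if_cong)
    then show ?thesis
      by (simp add: component_sum component_scale mult.commute)
  qed
  have "matrix_action A (component_poly e m) =
      (\<Sum>p\<in>UNIV. poly_scale (\<Sum>q\<in>UNIV. component e m (axis q 1) * A $ q $ p) (poly_var p))"
    unfolding component_poly_def matrix_action_sum matrix_action_scale matrix_action_poly_var
      poly.scale_sum_right poly.scale_sum_left
    by (subst sum.swap) simp
  also have "\<dots> = (\<Sum>s\<in>UNIV. poly_scale (M m s) (component_poly e s))"
    unfolding col Av component_poly_def poly.scale_sum_right poly.scale_sum_left
    by (subst sum.swap) simp
  finally show ?thesis .
qed

lemma matrix_action_induced_monomial:
  "matrix_action A (induced_monomial e \<beta>) =
    (\<Sum>m\<in>UNIV. poly_scale (of_nat (Poly_Mapping.lookup \<beta> m))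
      (matrix_action A (component_poly e m) * induced_monomial e (\<beta> - Poly_Mapping.single m 1)))"
proof -
  \<comment> \<open>The factors left over by the Leibniz rule form one induced monomial; this holds
    at exponent zero too, since both sides truncate alike.\<close>
  have "component_poly e m ^ (Poly_Mapping.lookup \<beta> m - 1) *
      (\<Prod>i\<in>UNIV - {m}. component_poly e i ^ Poly_Mapping.lookup \<beta> i) =
      induced_monomial e (\<beta> - Poly_Mapping.single m 1)" for m
  proof -
    have "(\<Prod>i\<in>UNIV - {m}. component_poly e i ^ Poly_Mapping.lookup \<beta> i) =
        (\<Prod>i\<in>UNIV - {m}. component_poly e i ^ Poly_Mapping.lookup (\<beta> - Poly_Mapping.single m 1) i)"
      by (intro prod.cong) (auto simp: lookup_minus lookup_single when_def)
    then show ?thesis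
      unfolding induced_monomial_def by (subst (2) prod.remove[of _ m]) (simp_all add: lookup_minus)
  qed
  then show ?thesis
    unfolding poly_scale_of_nat
    by (subst (1) induced_monomial_def)
      (simp add: derivation_prod_power[of "matrix_action A", OF matrix_action_mult] mult.assoc)
qed

end

section \<open>Triangularity in lexicographic order and the theorem\<close>

lemma upper_triangular_matrix_action:
  fixes e :: "'n::{finite,linorder} \<Rightarrow> complex^'n::{finite,linorder}"
  assumes "basis_of (*s) e UNIV UNIV" "upper_triangular_in (*s) e UNIV ((*v) A)"
  shows "upper_triangular_in poly_scale (induced_monomial e) {\<beta>. total_degree \<beta> = r}
    (\<lambda>P. matrix_action A P - poly_scale c P)"
proof (rule poly.upper_triangular_inI[OF finite_exponents])
  interpret complex_basis e
    by unfold_locales (fact assms(1))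
  show "inj_on (induced_monomial e) {\<beta>. total_degree \<beta> = r}"
    using induced_monomials_basis[of r] by (simp add: basis_of_def)
  obtain M where M: "\<And>s. A *v e s = (\<Sum>i\<in>UNIV. M i s *s e i)"
    and tri: "\<And>i s. s < i \<Longrightarrow> M i s = 0"
    using assms(2) by (auto simp: upper_triangular_in_def)
  fix \<beta> :: "'n \<Rightarrow>\<^sub>0 nat"
  assume "\<beta> \<in> {\<beta>. total_degree \<beta> = r}"
  then have deg: "total_degree \<beta> = r" by simp
  \<comment> \<open>The flag member at \<beta>; each term of the double sum over \<open>m\<close>
    and \<open>s\<close> is shown to lie in it.\<close>
  let ?W = "poly.span (induced_monomial e ` {\<gamma> \<in> {\<beta>. total_degree \<beta> = r}. \<gamma> \<le> \<beta>})"
  have "poly_scale (of_nat (Poly_Mapping.lookup \<beta> m)) (poly_scale (M m s) (component_poly e s)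
      * induced_monomial e (\<beta> - Poly_Mapping.single m 1)) \<in> ?W" for m s
  proof (cases "Poly_Mapping.lookup \<beta> m = 0 \<or> s < m")
    \<comment> \<open>Such a term has a zero factor: the exponent at \<open>m\<close>, or an entry
      of \<open>M\<close> below the diagonal.\<close>
    case True
    then have "poly_scale (of_nat (Poly_Mapping.lookup \<beta> m)) (poly_scale (M m s) (component_poly e s)
        * induced_monomial e (\<beta> - Poly_Mapping.single m 1)) = 0"
      by (auto simp: tri)
    then show ?thesis by (simp only: poly.span_zero)
  next
    case False
    let ?\<gamma> = "\<beta> - Poly_Mapping.single m 1"
    have \<beta>: "\<beta> = Poly_Mapping.single m 1 + ?\<gamma>"
      using False by (intro exponent_split) simp
    \<comment> \<open>For \<open>s = m\<close> this exponent is \<beta> itself, the diagonal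
      contribution; for \<open>m < s\<close> it is strictly smaller.\<close>
    have "?\<gamma> + Poly_Mapping.single s 1 \<le> \<beta>"
    proof (cases "s = m")
      case True
      then show ?thesis using \<beta> by (simp add: add.commute)
    next
      case False
      then show ?thesis
        using \<open>\<not> (Poly_Mapping.lookup \<beta> m = 0 \<or> s < m)\<close>
        by (intro less_imp_le[OF exponent_shift_less]) auto
    qed
    moreover have "total_degree (?\<gamma> + Poly_Mapping.single s 1) = r"
      using deg arg_cong[OF \<beta>, of total_degree] by (simp add: total_degree_add total_degree_single)
    ultimately have "component_poly e s * induced_monomial e ?\<gamma> \<in> ?W"
      unfolding component_poly_mult_induced_monomial by (intro poly.span_base) auto
    moreover have "poly_scale (M m s) (component_poly e s) * induced_monomial e ?\<gamma> =
        poly_scale (M m s) (component_poly e s * induced_monomial e ?\<gamma>)"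
      by (simp only: poly_scale_conv_mult mult.assoc)
    ultimately show ?thesis
      by (simp only: poly.span_scale)
  qed
  then have "matrix_action A (induced_monomial e \<beta>) \<in> ?W"
    unfolding matrix_action_induced_monomial matrix_action_component_poly[OF M] sum_distrib_right
      poly.scale_sum_right
    by (intro poly.span_sum)
  moreover have "induced_monomial e \<beta> \<in> ?W"
    using deg by (intro poly.span_base) auto
  ultimately show "matrix_action A (induced_monomial e \<beta>) - poly_scale c (induced_monomial e \<beta>) \<in> ?W"
    by (intro poly.span_diff poly.span_scale)
qed

theorem proposition10:
  fixes Y X :: "'n::{finite,linorder} \<Rightarrow> real^'n::{finite,linorder} \<Rightarrow> real^'n::{finite,linorder}"
    and \<alpha> :: "real^'n::{finite,linorder}^'n::{finite,linorder}"
    and \<delta> :: "'n \<Rightarrow> real"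
    and e :: "'n \<Rightarrow> complex^'n::{finite,linorder}"
    and r :: nat
  assumes "\<And>k. linear (Y k)"
    and "\<And>k l x. lie_bracket (Y k) (Y l) x = 0"
    and "wedge_all Y \<noteq> (\<lambda>x. 0)"
    and "transpose \<alpha> = - \<alpha>"
    and "\<And>j x. X j x = (\<Sum>k\<in>UNIV. (\<alpha> $ j $ k) *\<^sub>R Y k x)"
    and "\<And>j x. divergence (X j) x = \<delta> j"
    and "basis_of (*s) e UNIV UNIV"
    and "\<And>k. upper_triangular_in (*s) e UNIV
           (\<lambda>v. map_matrix complex_of_real (matrix (Y k)) *v v)"
  shows "basis_of poly_scale (induced_monomial e) {\<beta>. total_degree \<beta> = r}
           (homogeneous r :: ('n, complex) polynomial set) \<and>
         (\<forall>j. upper_triangular_in poly_scale (induced_monomial e) {\<beta>. total_degree \<beta> = r}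
           (complexify (\<lambda>P. field_action (X j) P - poly_scale (\<delta> j) P)))"
proof -
  \<comment> \<open>The matrix of \<open>X j\<close> is the combination of those of the
    \<open>Y k\<close> with coefficients from row \<open>j\<close> of \<alpha>, and triangularity in
    one fixed basis survives linear combinations.\<close>
  have "upper_triangular_in (*s) e UNIV ((*v) (map_matrix complex_of_real (matrix (X j))))" for j
  proof -
    obtain M where M: "\<And>k s. map_matrix complex_of_real (matrix (Y k)) *v e s = (\<Sum>i\<in>UNIV. M k i s *s e i)"
      and tri: "\<And>k i s. s < i \<Longrightarrow> M k i s = 0"
      using assms(8) unfolding upper_triangular_in_def by (simp, metis)
    have "map_matrix complex_of_real (matrix (X j)) *v v =
        (\<Sum>k\<in>UNIV. complex_of_real (\<alpha> $ j $ k) *s (map_matrix complex_of_real (matrix (Y k)) *v v))" for v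
      by (simp add: vec_eq_iff matrix_vector_mult_def map_matrix_def matrix_def assms(5)
          sum_distrib_left sum_distrib_right mult.assoc) (intro allI sum.swap)
    then have "map_matrix complex_of_real (matrix (X j)) *v e s =
        (\<Sum>i\<in>UNIV. (\<Sum>k\<in>UNIV. complex_of_real (\<alpha> $ j $ k) * M k i s) *s e i)" for s
      by (simp only: M vec.scale_sum_right vec.scale_sum_left vec.scale_scale) (rule sum.swap)
    then show ?thesis
      unfolding upper_triangular_in_def
      by (intro exI[of _ "\<lambda>i s. \<Sum>k\<in>UNIV. complex_of_real (\<alpha> $ j $ k) * M k i s"]) (simp add: tri)
  qed
  \<comment> \<open>After \<open>complexify_field_action\<close>, the divergence enters only as the
    scalar \<open>c\<close> of \<open>upper_triangular_matrix_action\<close>.\<close>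
  then show ?thesis
    using complex_basis.induced_monomials_basis[of e r] assms(7)
    by (simp add: complex_basis_def complexify_field_action upper_triangular_matrix_action)
qed

end
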